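(* Let $M$ be a connected binary matroid. If $M$ has a pair of skew circuits, then $M$ is not circuit-difference.
   Context: All matroids are finite. A matroid $M$ is circuit-difference if the symmetric difference $C_1\triangle C_2$ is a circuit of $M$ whenever $C_1$ and $C_2$ are distinct circuits of $M$ with $C_1\cap C_2\neq\emptyset$. Subsets $X$ and $Y$ of $E(M)$ are skew if $r(X\cup Y)=r(X)+r(Y)$, where $r$ is the rank function of $M$. A pair of skew circuits consists of two distinct circuits that are skew. *)

theory Defs
  imports Complex_Main "HOL-Library.Z2" "HOL-Library.Function_Algebras"
begin

locale matroid =
  fixes E :: "'a set" and indep :: "'a set \<Rightarrow> bool"
  assumes finite_ground: "finite E"
    and indep_subset_ground: "indep I \<Longrightarrow> I \<subseteq> E"
    and indep_empty: "indep {}"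
    and indep_subset: "indep J \<Longrightarrow> I \<subseteq> J \<Longrightarrow> indep I"
    and augment: "indep I \<Longrightarrow> indep J \<Longrightarrow> card I < card J \<Longrightarrow> \<exists>e\<in>J - I. indep (insert e I)"
begin

definition circuit :: "'a set \<Rightarrow> bool" where
  "circuit C \<longleftrightarrow> C \<subseteq> E \<and> \<not> indep C \<and> (\<forall>X. X \<subset> C \<longrightarrow> indep X)"

definition rank :: "'a set \<Rightarrow> nat" where
  "rank X = Max {card I |I. I \<subseteq> X \<and> indep I}"

definition skew :: "'a set \<Rightarrow> 'a set \<Rightarrow> bool" where
  "skew X Y \<longleftrightarrow> X \<subseteq> E \<and> Y \<subseteq> E \<and> rank (X \<union> Y) = rank X + rank Y"

definition connected_matroid :: bool where
  "connected_matroid \<longleftrightarrow>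
    (\<forall>e\<in>E. \<forall>f\<in>E. e \<noteq> f \<longrightarrow> (\<exists>C. circuit C \<and> e \<in> C \<and> f \<in> C))"

definition circuit_difference :: bool where
  "circuit_difference \<longleftrightarrow>
    (\<forall>C1 C2. circuit C1 \<and> circuit C2 \<and> C1 \<noteq> C2 \<and> C1 \<inter> C2 \<noteq> {}
      \<longrightarrow> circuit ((C1 - C2) \<union> (C2 - C1)))"

end

global_interpretation gf2: vector_space "\<lambda>(c::bit) (v::nat \<Rightarrow> bit) i. c * v i"
  by unfold_locales (auto simp: fun_eq_iff algebra_simps)

text \<open>Representability over GF(2). The vectors live in the space of all sequences over GF(2); as the
  ground set is finite, their span is finite-dimensional, and every finite-dimensional space over GF(2)
  embeds into this one. Since \<open>gf2.independent\<close> is a property of sets, injectivity on \<open>X\<close> is what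
  makes it linear independence of the family \<open>(\<phi> e)\<close> for \<open>e\<close> in \<open>X\<close>: parallel elements are
  represented by equal vectors.\<close>

definition (in matroid) binary :: bool where
  "binary \<longleftrightarrow>
    (\<exists>\<phi> :: 'a \<Rightarrow> nat \<Rightarrow> bit.
      \<forall>X\<subseteq>E. indep X \<longleftrightarrow> inj_on \<phi> X \<and> gf2.independent (\<phi> ` X))"

end

theory Submission imports Defs begin

text \<open>Let \<open>C1\<close> and \<open>C2\<close> be skew circuits of a circuit-difference matroid. Since
  \<open>C1 \<union> C2\<close> has rank at least \<open>|C1| + |C2| - 2\<close>, it has an independent subset \<open>I\<close> of that size;
  this forces \<open>C1\<close> and \<open>C2\<close> to be disjoint, and \<open>I\<close> omits exactly one element \<open>a\<close> of \<open>C1\<close> and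
  one element \<open>b\<close> of \<open>C2\<close>. By connectedness some circuit \<open>D\<close> contains \<open>a\<close> and \<open>b\<close>, and
  circuit-difference makes \<open>D \<triangle> C1\<close> and then \<open>D2 = D \<triangle> C1 \<triangle> C2\<close> circuits. As \<open>D2\<close> avoids \<open>a\<close> and
  \<open>b\<close> but does not lie in \<open>I\<close>, it leaves \<open>C1 \<union> C2\<close>, and there it meets \<open>D\<close>. So
  \<open>D \<triangle> D2 = C1 \<union> C2\<close> is a circuit properly containing \<open>C1\<close>, which is absurd.\<close>

context matroid
begin

lemma circuit_not_subset_indep: "circuit C \<Longrightarrow> indep I \<Longrightarrow> \<not> C \<subseteq> I"
  unfolding circuit_def using indep_subset by blast

lemma circuit_not_psubset: "circuit C \<Longrightarrow> circuit D \<Longrightarrow> \<not> C \<subset> D"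
  unfolding circuit_def by blast

lemma circuit_nonempty: "circuit C \<Longrightarrow> C \<noteq> {}"
  unfolding circuit_def using indep_empty by blast

lemma circuit_finite: "circuit C \<Longrightarrow> finite C"
  unfolding circuit_def using finite_ground finite_subset by blast

lemma circuit_differenceD:
  assumes "circuit_difference" "circuit C" "circuit D" "C \<noteq> D" "C \<inter> D \<noteq> {}"
  shows "circuit ((C - D) \<union> (D - C))"
  using assms unfolding circuit_difference_def by blast

lemma finite_indep_cards: "finite {card I |I. I \<subseteq> X \<and> indep I}"
proof -
  have "{card I |I. I \<subseteq> X \<and> indep I} \<subseteq> card ` Pow E"
    using indep_subset_ground by auto
  then show ?thesis
    using finite_ground finite_subset by blast
qed

lemma card_le_rank: "I \<subseteq> X \<Longrightarrow> indep I \<Longrightarrow> card I \<le> rank X"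
  unfolding rank_def using finite_indep_cards by (intro Max_ge) auto

lemma rank_witness: obtains I where "I \<subseteq> X" "indep I" "card I = rank X"
proof -
  have "{card I |I. I \<subseteq> X \<and> indep I} \<noteq> {}"
    using indep_empty by blast
  from Max_in[OF finite_indep_cards this] show ?thesis
    unfolding rank_def[symmetric] using that by auto
qed

text \<open>Deleting any one element of a circuit leaves an independent set.\<close>

lemma card_circuit_le: assumes "circuit C" shows "card C \<le> rank C + 1"
proof -
  obtain x where x: "x \<in> C"
    using circuit_nonempty[OF assms] by blast
  have "indep (C - {x})"
    using assms x unfolding circuit_def by blast
  then have "card (C - {x}) \<le> rank C"
    by (intro card_le_rank) auto
  then show ?thesis
    using x circuit_finite[OF assms] by simp
qed

lemma skew_circuits_indep:
  assumes "circuit C1" "circuit C2" "skew C1 C2"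
  obtains I where "I \<subseteq> C1 \<union> C2" "indep I" "card C1 + card C2 \<le> card I + 2"
proof -
  obtain I where "I \<subseteq> C1 \<union> C2" "indep I" "card I = rank (C1 \<union> C2)"
    by (rule rank_witness)
  then show ?thesis
    using that card_circuit_le[OF assms(1)] card_circuit_le[OF assms(2)] assms(3)
    unfolding skew_def by force
qed

lemma circuit_difference_skew_circuits:
  assumes cd: "circuit_difference" and C: "circuit C1" "circuit C2" "C1 \<noteq> C2" and "skew C1 C2"
  obtains a b where "C1 \<inter> C2 = {}" "a \<in> C1" "b \<in> C2" "indep (C1 \<union> C2 - {a, b})"
proof -
  obtain I where I: "I \<subseteq> C1 \<union> C2" "indep I" "card C1 + card C2 \<le> card I + 2"
    using skew_circuits_indep assms by blast
  have fin: "finite C1" "finite C2"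
    using C circuit_finite by auto
  define J where "J = C1 \<union> C2 - I"
  have IJ: "I = C1 \<union> C2 - J"
    using I unfolding J_def by blast
  have finJ: "finite J"
    unfolding J_def using fin by simp
  have "card J + card I = card (C1 \<union> C2)"
    unfolding J_def using I(1) fin
    by (metis card_Diff_subset card_mono finite_UnI finite_subset le_add_diff_inverse2)
  moreover have "card (C1 \<union> C2) + card (C1 \<inter> C2) = card C1 + card C2"
    using card_Un_Int[OF fin] by simp
  \<comment> \<open>The allowance of 2, one element per circuit, is shared between the elements that
    \<open>I\<close> omits and the overlap of the circuits.\<close>
  ultimately have small: "card J + card (C1 \<inter> C2) \<le> 2"
    using I(3) by linarith
  obtain a where a: "a \<in> C1" "a \<in> J"
    using circuit_not_subset_indep[OF C(1) I(2)] unfolding J_def by blast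
  obtain b where b: "b \<in> C2" "b \<in> J"
    using circuit_not_subset_indep[OF C(2) I(2)] unfolding J_def by blast
  have disj: "C1 \<inter> C2 = {}"
  proof (rule ccontr)
    assume ne: "C1 \<inter> C2 \<noteq> {}"
    then have "card (C1 \<inter> C2) \<ge> 1"
      using fin by (simp add: Suc_leI card_gt_0_iff)
    then have "card J \<le> 1"
      using small by linarith
    \<comment> \<open>The single omitted element lies in both circuits, so their symmetric
      difference avoids it and would be a circuit inside \<open>I\<close>.\<close>
    then have J: "J = {a}" "a = b"
      using a b finJ by (metis card_le_Suc0_iff_eq One_nat_def is_singletonI' is_singleton_def
          singletonD empty_iff)+
    have "circuit ((C1 - C2) \<union> (C2 - C1))"
      using circuit_differenceD[OF cd C ne] .
    moreover have "(C1 - C2) \<union> (C2 - C1) \<subseteq> I"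
      using a b J IJ by blast
    ultimately show False
      using circuit_not_subset_indep I(2) by blast
  qed
  then have "a \<noteq> b"
    using a b by blast
  then have "J = {a, b}"
    using small finJ a b card_seteq[of J "{a, b}"] by auto
  then show ?thesis
    using that[OF disj a(1) b(1)] I(2) IJ by simp
qed

lemma connected_skew_circuits_not_circuit_difference:
  assumes conn: "connected_matroid" and C: "circuit C1" "circuit C2" "C1 \<noteq> C2"
    and "skew C1 C2"
  shows "\<not> circuit_difference"
proof
  assume cd: "circuit_difference"
  obtain a b where disj: "C1 \<inter> C2 = {}" and ab: "a \<in> C1" "b \<in> C2"
    and ind: "indep (C1 \<union> C2 - {a, b})"
    using circuit_difference_skew_circuits cd assms by blast
  have "a \<in> E" "b \<in> E" "a \<noteq> b"
    using ab C disj unfolding circuit_def by auto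
  then obtain D where D: "circuit D" "a \<in> D" "b \<in> D"
    using conn unfolding connected_matroid_def by blast
  define D1 where "D1 = (D - C1) \<union> (C1 - D)"
  have "D \<noteq> C1" "D \<inter> C1 \<noteq> {}"
    using D ab disj by auto
  then have D1: "circuit D1"
    unfolding D1_def using circuit_differenceD[OF cd D(1) C(1)] by blast
  define D2 where "D2 = (D1 - C2) \<union> (C2 - D1)"
  \<comment> \<open>Equality would give \<open>D = C1 \<union> C2\<close>, a circuit properly
    containing \<open>C1\<close>.\<close>
  have "D1 \<noteq> C2"
    using circuit_not_psubset[OF C(1) D(1)] disj D ab unfolding D1_def by blast
  \<comment> \<open>The element \<open>b\<close> survives in \<open>D1\<close>, as it lies in
    \<open>D\<close> but not in \<open>C1\<close>.\<close>
  moreover have "D1 \<inter> C2 \<noteq> {}"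
    using D ab disj unfolding D1_def by blast
  ultimately have D2: "circuit D2"
    unfolding D2_def using circuit_differenceD[OF cd D1 C(2)] by blast
  have "a \<notin> D2" "b \<notin> D2"
    using D ab disj unfolding D2_def D1_def by auto
  then have "\<not> D2 \<subseteq> C1 \<union> C2"
    using circuit_not_subset_indep[OF D2 ind] by blast
  \<comment> \<open>Outside \<open>C1 \<union> C2\<close> the sets \<open>D\<close> and
    \<open>D2\<close> agree.\<close>
  then have "D \<inter> D2 \<noteq> {}"
    unfolding D2_def D1_def by blast
  moreover have "D \<noteq> D2"
    using D(2) \<open>a \<notin> D2\<close> by blast
  ultimately have "circuit ((D - D2) \<union> (D2 - D))"
    using circuit_differenceD[OF cd D(1) D2] by blast
  moreover have "(D - D2) \<union> (D2 - D) = C1 \<union> C2"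
    using disj unfolding D2_def D1_def by blast
  ultimately have "circuit (C1 \<union> C2)"
    by simp
  moreover have "C1 \<subset> C1 \<union> C2"
    using disj ab by blast
  ultimately show False
    using circuit_not_psubset[OF C(1)] by blast
qed

end

theorem lemma1p2:
  fixes E :: "'a set" and indep :: "'a set \<Rightarrow> bool"
  assumes "matroid E indep"
    and "matroid.connected_matroid E indep"
    and "matroid.binary E indep"
    and "\<exists>C1 C2. matroid.circuit E indep C1 \<and> matroid.circuit E indep C2 \<and> C1 \<noteq> C2
      \<and> matroid.skew E indep C1 C2"
  shows "\<not> matroid.circuit_difference E indep"
  using assms(2,4) matroid.connected_skew_circuits_not_circuit_difference[OF assms(1)] by blast

end
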